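(* Let $S$ be a semigroup and let $P$ be a subsemigroup of $S$. Then $P$ is a prime ideal of $S$ if and only if the complement $S\setminus P$ is a unitary subsemigroup of $S$.
   Context: An ideal $P$ of a semigroup $S$ (two-sided: $SP\subseteq P$ and $PS\subseteq P$) is called a prime ideal if $P\neq S$ and, for all $a,b\in S$, $ab\in P$ implies $a\in P$ or $b\in P$. A subsemigroup $U$ of $S$ is called unitary if, for all $a,b\in S$, $ab\in U$ and $a\in U$ imply $b\in U$, and $ab\in U$ and $b\in U$ imply $a\in U$. Semigroups and subsemigroups are non-empty by convention. *)

theory Defs
  imports Main
begin

text \<open>
  The ambient semigroup is the whole of a type of class \<^class>\<open>semigroup_mult\<close>; it is
  non-empty because every type is.  Subsemigroups and ideals are subsets of that type and are
  required to be non-empty.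
\<close>

definition subsemigroup :: "'a::semigroup_mult set \<Rightarrow> bool" where
  "subsemigroup U \<longleftrightarrow> U \<noteq> {} \<and> (\<forall>a\<in>U. \<forall>b\<in>U. a * b \<in> U)"

definition semigroup_ideal :: "'a::semigroup_mult set \<Rightarrow> bool" where
  "semigroup_ideal P \<longleftrightarrow> P \<noteq> {} \<and> (\<forall>s. \<forall>p\<in>P. s * p \<in> P) \<and> (\<forall>p\<in>P. \<forall>s. p * s \<in> P)"

definition prime_semigroup_ideal :: "'a::semigroup_mult set \<Rightarrow> bool" where
  "prime_semigroup_ideal P \<longleftrightarrow>
     semigroup_ideal P \<and> P \<noteq> UNIV \<and> (\<forall>a b. a * b \<in> P \<longrightarrow> a \<in> P \<or> b \<in> P)"

definition unitary_subsemigroup :: "'a::semigroup_mult set \<Rightarrow> bool" where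
  "unitary_subsemigroup U \<longleftrightarrow>
     subsemigroup U \<and>
     (\<forall>a b. a * b \<in> U \<and> a \<in> U \<longrightarrow> b \<in> U) \<and>
     (\<forall>a b. a * b \<in> U \<and> b \<in> U \<longrightarrow> a \<in> U)"

end

theory Submission
  imports Defs
begin

text \<open>Primeness of \<open>P\<close> is closure of the complement under products, and
  \<open>P \<noteq> UNIV\<close> is its non-emptiness. The ideal property corresponds to unitarity:
  a product outside an ideal has both factors outside it.\<close>

theorem theorem9:
  fixes P :: "'a::semigroup_mult set"
  assumes "subsemigroup P"
  shows "prime_semigroup_ideal P \<longleftrightarrow> unitary_subsemigroup (UNIV - P)"
proof
  assume "prime_semigroup_ideal P"
  then show "unitary_subsemigroup (UNIV - P)"
    unfolding prime_semigroup_ideal_def semigroup_ideal_def unitary_subsemigroup_def subsemigroup_def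
    by blast
next
  assume U: "unitary_subsemigroup (UNIV - P)"
  \<comment> \<open>Split on \<open>s\<close>: if \<open>s \<in> P\<close>, closure of
    \<open>P\<close> suffices; if not, a product outside \<open>P\<close> would by unitarity force
    \<open>p\<close> outside \<open>P\<close>.\<close>
  have "s * p \<in> P" "p * s \<in> P" if "p \<in> P" for s p
    using U assms that unfolding unitary_subsemigroup_def subsemigroup_def by blast+
  with U assms show "prime_semigroup_ideal P"
    unfolding prime_semigroup_ideal_def semigroup_ideal_def unitary_subsemigroup_def subsemigroup_def
    by blast
qed

end
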